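(* Let $\lambda\in\mathbb{C}$ with $\lambda\neq 1$. For every integer $k\in\mathbb{Z}$, every integer $r\geq 0$ and every integer $n\geq 0$, $$B_{n}^{(k)}(x)=\frac{1}{(1-\lambda)^{r}}\sum_{m=0}^{n}\left\{\binom{n}{m}\sum_{j=0}^{r}\binom{r}{j}(-\lambda)^{r-j}B_{n-m}^{(k)}(j)\right\}H_{m}^{(r)}(x\mid\lambda).$$
   Context: For $k\in\mathbb{Z}$, the polylogarithm is $Li_k(x)=\sum_{m=1}^{\infty}\frac{x^m}{m^k}$. The poly-Bernoulli polynomials $B_n^{(k)}(x)$ are defined by the generating function (an identity of formal power series in $t$) $$\frac{Li_{k}(1-e^{-t})}{1-e^{-t}}e^{xt}=\sum_{n=0}^{\infty}B_{n}^{(k)}(x)\frac{t^{n}}{n!}.$$ For $\lambda\in\mathbb{C}$, $\lambda\ne1$, the Frobenius–Euler polynomials of order $r$ are defined by $\left(\frac{1-\lambda}{e^t-\lambda}\right)^r e^{xt}=\sum_{n=0}^\infty H_n^{(r)}(x\mid\lambda)\frac{t^n}{n!}$. *)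

theory Defs
  imports Complex_Main "HOL-Computational_Algebra.Computational_Algebra"
begin

definition polylog_fps :: "int \<Rightarrow> complex fps" where
  "polylog_fps k = Abs_fps (\<lambda>m. if m = 0 then 0 else 1 / of_nat m powi k)"

(* Series in t whose coefficients are polynomials in the indeterminate x:
   const_series embeds C[[t]] into C[x][[t]], and exp_xt is the series e^(xt). *)

definition const_series :: "complex fps \<Rightarrow> complex poly fps" where
  "const_series F = Abs_fps (\<lambda>n. [:fps_nth F n:])"

definition exp_xt :: "complex poly fps" where
  "exp_xt = Abs_fps (\<lambda>n. monom (1 / fact n) n)"

(* Both 1 - e^(-t) and Li_k(1 - e^(-t)) have order 1 in t, so the division of formal
   power series is exact. *)
definition poly_bernoulli_gf :: "int \<Rightarrow> complex fps" where
  "poly_bernoulli_gf k =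
     fps_compose (polylog_fps k) (1 - fps_exp (-1)) / (1 - fps_exp (-1))"

definition poly_bernoulli :: "int \<Rightarrow> nat \<Rightarrow> complex poly" where
  "poly_bernoulli k n =
     smult (fact n) (fps_nth (const_series (poly_bernoulli_gf k) * exp_xt) n)"

(* For lam \<noteq> 1 the denominator has nonzero constant term 1 - lam, so it is a unit. *)
definition frobenius_euler_gf :: "nat \<Rightarrow> complex \<Rightarrow> complex fps" where
  "frobenius_euler_gf r lam =
     (fps_const (1 - lam) / (fps_exp 1 - fps_const lam)) ^ r"

definition frobenius_euler :: "nat \<Rightarrow> complex \<Rightarrow> nat \<Rightarrow> complex poly" where
  "frobenius_euler r lam n =
     smult (fact n) (fps_nth (const_series (frobenius_euler_gf r lam) * exp_xt) n)"

lemma poly_const_series_mult_exp_xt: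
  "poly (fps_nth (const_series F * exp_xt) n) x = fps_nth (F * fps_exp x) n"
  by (simp add: const_series_def exp_xt_def fps_mult_nth poly_sum poly_monom)

lemma poly_bernoulli_gf_exact:
  "poly_bernoulli_gf k * (1 - fps_exp (-1)) =
     fps_compose (polylog_fps k) (1 - fps_exp (-1))"
proof -
  let ?u = "1 - fps_exp (-1) :: complex fps"
  have u1: "fps_nth ?u 1 \<noteq> 0" and u0: "fps_nth ?u 0 = 0" by simp_all
  have "subdegree ?u = 1"
    using u1 u0 by (intro subdegreeI) auto
  moreover have "subdegree (polylog_fps k) = 1"
    by (intro subdegreeI) (auto simp: polylog_fps_def)
  ultimately have "?u dvd fps_compose (polylog_fps k) ?u"
    using u1
    by (cases "fps_compose (polylog_fps k) ?u = 0") (simp, subst fps_dvd_iff, auto)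
  then show ?thesis unfolding poly_bernoulli_gf_def by simp
qed

lemma poly_bernoulli_generating_function:
  "Abs_fps (\<lambda>n. poly (poly_bernoulli k n) x / fact n) = poly_bernoulli_gf k * fps_exp x"
  by (rule fps_ext) (simp add: poly_bernoulli_def poly_const_series_mult_exp_xt)

lemma frobenius_euler_generating_function:
  "Abs_fps (\<lambda>n. poly (frobenius_euler r lam n) x / fact n) =
     frobenius_euler_gf r lam * fps_exp x"
  by (rule fps_ext) (simp add: frobenius_euler_def poly_const_series_mult_exp_xt)

end

(* Multiplying the generating function of the poly-Bernoulli polynomials by
   ((e^t - lam) / (e^t - lam))^r and expanding the numerator binomially into a combination
   of the exponentials e^(jt), one factor collects the values B_i^(k)(j), and the other is
   the Frobenius-Euler generating function up to (1 - lam)^r; the theorem compares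
   coefficients of t^n. *)

theory Submission
  imports Defs
begin

lemma poly_poly_bernoulli:
  "poly (poly_bernoulli k n) x = fact n * fps_nth (poly_bernoulli_gf k * fps_exp x) n"
  by (simp add: poly_bernoulli_def poly_const_series_mult_exp_xt)

lemma poly_frobenius_euler:
  "poly (frobenius_euler r lam n) x = fact n * fps_nth (frobenius_euler_gf r lam * fps_exp x) n"
  by (simp add: frobenius_euler_def poly_const_series_mult_exp_xt)

text \<open>The constant term \<open>1 - lam\<close> of the denominator is nonzero, so the quotient
  of series is exact, and this passes to \<open>r\<close>-th powers.\<close>

lemma frobenius_euler_gf_exact:
  assumes "lam \<noteq> 1"
  shows "(fps_exp 1 - fps_const lam) ^ r * frobenius_euler_gf r lam = fps_const ((1 - lam) ^ r)"
proof -
  let ?D = "fps_exp 1 - fps_const lam :: complex fps"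
  have "is_unit ?D"
    using assms by (simp only: fps_is_unit_iff) simp
  then have "?D * (fps_const (1 - lam) / ?D) = fps_const (1 - lam)"
    by (rule dvd_mult_div_cancel[OF unit_imp_dvd])
  then show ?thesis
    unfolding frobenius_euler_gf_def power_mult_distrib[symmetric] by (simp only: fps_const_power)
qed

text \<open>Binomial theorem, with the \<open>j\<close>-th power of e^t rewritten as e^(jt): each
  term then acts on a generating function as an evaluation at \<open>j\<close>.\<close>

lemma fps_exp_diff_const_power:
  fixes a :: "'a::field_char_0"
  shows "(fps_exp 1 - fps_const a) ^ r =
    (\<Sum>j=0..r. fps_const (of_nat (r choose j) * (- a) ^ (r - j)) * fps_exp (of_nat j))"
proof -
  have "(fps_exp 1 - fps_const a) ^ r = (fps_exp 1 + fps_const (- a)) ^ r"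
    by (simp flip: fps_const_neg)
  also have "\<dots> =
      (\<Sum>j\<le>r. of_nat (r choose j) * fps_exp 1 ^ j * fps_const (- a) ^ (r - j))"
    by (rule binomial_ring)
  also have "\<dots> =
      (\<Sum>j=0..r. fps_const (of_nat (r choose j) * (- a) ^ (r - j)) * fps_exp (of_nat j))"
    by (intro sum.cong)
      (auto simp: fps_exp_power_mult mult_ac
        simp flip: fps_const_mult fps_const_power fps_of_nat)
  finally show ?thesis .
qed

theorem theorem6:
  fixes lam :: complex and k :: int and r n :: nat and x :: complex
  assumes "lam \<noteq> 1"
  shows "poly (poly_bernoulli k n) x =
    1 / (1 - lam) ^ r *
      (\<Sum>m=0..n.
         (of_nat (n choose m) *
           (\<Sum>j=0..r. of_nat (r choose j) * (- lam) ^ (r - j) *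
              poly (poly_bernoulli k (n - m)) (of_nat j))) *
         poly (frobenius_euler r lam m) x)"
proof -
  define G where "G = poly_bernoulli_gf k"
  define P where "P = (fps_exp 1 - fps_const lam :: complex fps) ^ r"
  define H where "H = frobenius_euler_gf r lam * fps_exp x"
  \<comment> \<open>\<open>G * fps_exp (of_nat j)\<close> generates the values at \<open>j\<close>,
    so expanding \<open>P\<close> turns the inner sum of the claim into one coefficient of
    \<open>G * P\<close>.\<close>
  have inner: "(\<Sum>j=0..r. of_nat (r choose j) * (- lam) ^ (r - j) *
      poly (poly_bernoulli k i) (of_nat j)) = fact i * fps_nth (G * P) i" for i
  proof -
    have "G * P = (\<Sum>j=0..r.
        fps_const (of_nat (r choose j) * (- lam) ^ (r - j)) * (G * fps_exp (of_nat j)))"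
      unfolding P_def fps_exp_diff_const_power by (simp only: sum_distrib_left mult.left_commute)
    then have "fps_nth (G * P) i = (\<Sum>j=0..r.
        of_nat (r choose j) * (- lam) ^ (r - j) * fps_nth (G * fps_exp (of_nat j)) i)"
      by (simp only: fps_sum_nth fps_mult_left_const_nth)
    then show ?thesis
      by (simp only: poly_poly_bernoulli sum_distrib_left mult.left_commute flip: G_def)
  qed
  \<comment> \<open>Regrouped so that \<open>P\<close> meets the denominator inside \<open>H\<close>
    and only a constant survives.\<close>
  have "H * (G * P) = (P * frobenius_euler_gf r lam) * (G * fps_exp x)"
    unfolding H_def by (simp only: mult_ac)
  then have "H * (G * P) = fps_const ((1 - lam) ^ r) * (G * fps_exp x)"
    unfolding P_def frobenius_euler_gf_exact[OF assms] .
  then have "fps_nth (H * (G * P)) n = (1 - lam) ^ r * fps_nth (G * fps_exp x) n"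
    by (simp only: fps_mult_left_const_nth)
  then have "(1 - lam) ^ r * poly (poly_bernoulli k n) x = fact n * fps_nth (H * (G * P)) n"
    by (simp only: poly_poly_bernoulli mult.left_commute flip: G_def)
  \<comment> \<open>Only the outer product is expanded; \<open>G * P\<close> stays whole to match
    \<open>inner\<close>.\<close>
  also have "\<dots> = (\<Sum>m=0..n. fact n * (fps_nth H m * fps_nth (G * P) (n - m)))"
    by (simp add: fps_mult_nth[of H] sum_distrib_left)
  \<comment> \<open>\<open>fact n\<close> splits as
    \<open>(n choose m) * fact m * fact (n - m)\<close>; the factor \<open>fact m\<close> goes into
    the Frobenius-Euler value.\<close>
  also have "\<dots> = (\<Sum>m=0..n. (of_nat (n choose m) * (fact (n - m) * fps_nth (G * P) (n - m)))
      * poly (frobenius_euler r lam m) x)"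
    by (intro sum.cong) (auto simp: poly_frobenius_euler H_def binomial_fact)
  finally show ?thesis
    unfolding inner using assms by (simp add: divide_simps mult.commute)
qed

end
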